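(* Let $\mathbf{s}$ be a sequence of positive integers and $n\geq1$. The $h^*$-vector of $\mathcal{R}_n^{(\mathbf{s})}$ is symmetric if and only if $\mathcal{C}_n^{(\mathbf{s})}$ is Gorenstein.
   Context: $\mathcal{C}_n^{(\mathbf{s})}=\{\lambda\in\mathbb{R}^n: 0\leq\lambda_1/s_1\leq\cdots\leq\lambda_n/s_n\}$ and $\mathcal{L}_n^{(\mathbf{s})}=\mathcal{C}_n^{(\mathbf{s})}\cap\mathbb{Z}^n$. The rational lecture hall polytope is $\mathcal{R}_n^{(\mathbf{s})}=\{\lambda\in\mathcal{C}_n^{(\mathbf{s})}:\lambda_n\leq1\}$. For integers $t\geq0$ let $i(\mathcal{R}_n^{(\mathbf{s})},t)=|\{\lambda\in\mathcal{L}_n^{(\mathbf{s})}:\lambda_n\leq t\}|$, and let $\mathcal{E}_n^{(\mathbf{s})}(x)=\sum_{t\geq0} i(\mathcal{R}_n^{(\mathbf{s})},t)x^t$. It is known that $Q_n^{(\mathbf{s})}(x):=(1-x^{s_n})^{n+1}\mathcal{E}_n^{(\mathbf{s})}(x)$ is a polynomial (with positive integer coefficients); its coefficient sequence is the $h^*$-vector of $\mathcal{R}_n^{(\mathbf{s})}$, and the $h^*$-vector is symmetric if this coefficient sequence reads the same from left to right as from right to left. A pointed rational cone $\mathcal{C}\subset\mathbb{R}^n$ is Gorenstein if there is an integer point $\mathbf{c}$ in the interior $\mathcal{C}^\circ$ such that $\mathcal{C}^\circ\cap\mathbb{Z}^n=\mathbf{c}+(\mathcal{C}\cap\mathbb{Z}^n)$.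 *)

theory Defs
  imports "HOL-Analysis.Analysis" "HOL-Computational_Algebra.Polynomial_FPS"
begin

text \<open>
  Indices are shifted by one: \<open>x 0, \<dots>, x (n - 1)\<close> and \<open>s 0, \<dots>, s (n - 1)\<close> stand for
  $\lambda_1, \dots, \lambda_n$ and $s_1, \dots, s_n$.  The space $\mathbb{R}^n$ is the library's
  \<^term>\<open>Euclidean_space n\<close>: the functions \<open>nat \<Rightarrow> real\<close> that vanish from index \<open>n\<close> on, with the
  usual topology.  The last coordinates \<open>x (n - 1)\<close> and \<open>s (n - 1)\<close> are only meaningful for \<open>n \<ge> 1\<close>.
\<close>

definition lattice_points :: "nat \<Rightarrow> (nat \<Rightarrow> real) set" where
  "lattice_points n = {x \<in> topspace (Euclidean_space n). \<forall>i<n. x i \<in> \<int>}"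

definition lecture_hall_cone :: "nat \<Rightarrow> (nat \<Rightarrow> nat) \<Rightarrow> (nat \<Rightarrow> real) set" where
  "lecture_hall_cone n s =
    {x \<in> topspace (Euclidean_space n).
       0 \<le> x 0 / real (s 0) \<and>
       (\<forall>i. Suc i < n \<longrightarrow> x i / real (s i) \<le> x (Suc i) / real (s (Suc i)))}"

definition lecture_hall_partitions :: "nat \<Rightarrow> (nat \<Rightarrow> nat) \<Rightarrow> (nat \<Rightarrow> real) set" where
  "lecture_hall_partitions n s = lecture_hall_cone n s \<inter> lattice_points n"

definition rational_lecture_hall_polytope :: "nat \<Rightarrow> (nat \<Rightarrow> nat) \<Rightarrow> (nat \<Rightarrow> real) set" where
  "rational_lecture_hall_polytope n s = {x \<in> lecture_hall_cone n s. x (n - 1) \<le> 1}"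

definition lecture_hall_ehrhart :: "nat \<Rightarrow> (nat \<Rightarrow> nat) \<Rightarrow> nat \<Rightarrow> nat" where
  "lecture_hall_ehrhart n s t = card {x \<in> lecture_hall_partitions n s. x (n - 1) \<le> real t}"

definition lecture_hall_ehrhart_series :: "nat \<Rightarrow> (nat \<Rightarrow> nat) \<Rightarrow> int fps" where
  "lecture_hall_ehrhart_series n s = Abs_fps (\<lambda>t. int (lecture_hall_ehrhart n s t))"

text \<open>
  The power series on the right-hand side below is known to be a polynomial when \<open>n \<ge> 1\<close> and all
  \<open>s i\<close> are positive; the polynomial is then unique since \<^const>\<open>fps_of_poly\<close> is injective.
\<close>

definition h_star_polynomial :: "nat \<Rightarrow> (nat \<Rightarrow> nat) \<Rightarrow> int poly" where
  "h_star_polynomial n s =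
    (THE Q. fps_of_poly Q =
       (1 - fps_X ^ s (n - 1)) ^ (n + 1) * lecture_hall_ehrhart_series n s)"

text \<open>\<^const>\<open>coeffs\<close> lists the coefficients from degree 0 up to the (nonzero) leading one.\<close>

definition h_star_vector :: "nat \<Rightarrow> (nat \<Rightarrow> nat) \<Rightarrow> int list" where
  "h_star_vector n s = coeffs (h_star_polynomial n s)"

definition symmetric_vector :: "'a list \<Rightarrow> bool" where
  "symmetric_vector h \<longleftrightarrow> rev h = h"

text \<open>
  The Gorenstein property, for pointed rational cones \<open>C\<close> in $\mathbb{R}^n$ (such as the lecture
  hall cones).  The interior is taken in $\mathbb{R}^n$, not relative to the span of \<open>C\<close>.
\<close>

definition gorenstein_cone :: "nat \<Rightarrow> (nat \<Rightarrow> real) set \<Rightarrow> bool" where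
  "gorenstein_cone n C \<longleftrightarrow>
    (\<exists>c \<in> (Euclidean_space n interior_of C) \<inter> lattice_points n.
       (Euclidean_space n interior_of C) \<inter> lattice_points n =
       (\<lambda>x i. c i + x i) ` (C \<inter> lattice_points n))"

text \<open>
  The counting function is the Ehrhart function of the polytope: it counts the lattice points
  of its dilates.
\<close>

lemma lecture_hall_cone_le_last:
  assumes s: "\<And>i. s i > 0" and x: "x \<in> lecture_hall_cone n s" and "i < n"
  shows "0 \<le> x i / real (s i)" "x i / real (s i) \<le> x (n - 1) / real (s (n - 1))"
proof -
  have st: "x i / real (s i) \<le> x (Suc i) / real (s (Suc i))" if "Suc i < n" for i
    using x that by (auto simp: lecture_hall_cone_def)
  have "i < n \<longrightarrow> 0 \<le> x i / real (s i)"
  proof (induction i)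
    case 0
    then show ?case using x by (auto simp: lecture_hall_cone_def)
  next
    case (Suc i)
    then show ?case using st[of i] by linarith
  qed
  then show "0 \<le> x i / real (s i)" using \<open>i < n\<close> by blast
  have "i \<le> n - 1" using \<open>i < n\<close> by simp
  then show "x i / real (s i) \<le> x (n - 1) / real (s (n - 1))"
  proof (induction rule: inc_induct)
    case base
    then show ?case by simp
  next
    case (step m)
    have "Suc m < n" using step.hyps by linarith
    then show ?case using st[of m] step.IH by linarith
  qed
qed

lemma dilate_rational_lecture_hall_polytope:
  assumes s: "\<And>i. s i > 0" and n: "n \<ge> 1"
  shows "(\<lambda>x i. real t * x i) ` rational_lecture_hall_polytope n s =
         {x \<in> lecture_hall_cone n s. x (n - 1) \<le> real t}"
    (is "?L = ?R")
proof
  show "?L \<subseteq> ?R"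
  proof
    fix y assume "y \<in> ?L"
    then obtain x where x: "x \<in> lecture_hall_cone n s" "x (n - 1) \<le> 1" and y: "y = (\<lambda>i. real t * x i)"
      by (auto simp: rational_lecture_hall_polytope_def)
    have "real t * x i / real (s i) \<le> real t * x (Suc i) / real (s (Suc i))" if "Suc i < n" for i
      using mult_left_mono[of "x i / real (s i)" "x (Suc i) / real (s (Suc i))" "real t"] x(1) that
      by (auto simp: lecture_hall_cone_def)
    moreover have "0 \<le> real t * x 0 / real (s 0)"
      using mult_nonneg_nonneg[of "real t" "x 0 / real (s 0)"] x(1)
      by (auto simp: lecture_hall_cone_def)
    moreover have "real t * x (n - 1) \<le> real t"
      using mult_left_mono[OF x(2), of "real t"] by simp
    ultimately show "y \<in> ?R"
      using x(1) unfolding y lecture_hall_cone_def topspace_Euclidean_space by simp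
  qed
next
  show "?R \<subseteq> ?L"
  proof
    fix y assume y: "y \<in> ?R"
    show "y \<in> ?L"
    proof (cases "t = 0")
      case True
      have "y i = 0" for i
      proof (cases "i < n")
        case i: True
        have "y (n - 1) / real (s (n - 1)) \<le> 0"
          using y True by (simp add: divide_nonpos_nonneg)
        moreover have "y \<in> lecture_hall_cone n s"
          using y by simp
        note lecture_hall_cone_le_last[of s y n i, OF s this i]
        ultimately have "y i / real (s i) = 0"
          by linarith
        then show ?thesis using s[of i] by simp
      next
        case False
        then show ?thesis using y by (simp add: lecture_hall_cone_def topspace_Euclidean_space)
      qed
      then have "y = (\<lambda>i. real t * (\<lambda>_. 0) i)" by auto
      moreover have "(\<lambda>_. 0) \<in> rational_lecture_hall_polytope n s"
        by (simp add: rational_lecture_hall_polytope_def lecture_hall_cone_def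
            topspace_Euclidean_space)
      ultimately show ?thesis using image_eqI[where f = "\<lambda>x i. real t * x i" and x = "\<lambda>_. 0"]
        by blast
    next
      case False
      let ?x = "\<lambda>i. y i / real t"
      have "y i / real t / real (s i) \<le> y (Suc i) / real t / real (s (Suc i))" if "Suc i < n" for i
        using divide_right_mono[of "y i / real (s i)" "y (Suc i) / real (s (Suc i))" "real t"] y that
        by (auto simp: lecture_hall_cone_def mult.commute)
      moreover have "0 \<le> y 0 / real t / real (s 0)"
        using divide_nonneg_nonneg[of "y 0 / real (s 0)" "real t"] y
        by (auto simp: lecture_hall_cone_def mult.commute)
      ultimately have "?x \<in> rational_lecture_hall_polytope n s"
        using y False
        by (simp add: rational_lecture_hall_polytope_def lecture_hall_cone_def
            topspace_Euclidean_space)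
      moreover have "y = (\<lambda>i. real t * ?x i)" using False by simp
      ultimately show ?thesis using image_eqI[where f = "\<lambda>x i. real t * x i" and x = "?x"]
        by blast
    qed
  qed
qed

lemma lecture_hall_ehrhart_eq_dilate:
  assumes "\<And>i. s i > 0" and "n \<ge> 1"
  shows "lecture_hall_ehrhart n s t =
         card ((\<lambda>x i. real t * x i) ` rational_lecture_hall_polytope n s \<inter> lattice_points n)"
  unfolding dilate_rational_lecture_hall_polytope[of s n, OF assms] lecture_hall_ehrhart_def
    lecture_hall_partitions_def
  by (rule arg_cong[where f = card]) auto

end

theory Submission
  imports Defs
begin

text \<open>
  Let \<open>L\<close> and \<open>L\<degree>\<close> be the sets of lattice points of the cone and of its interior, and grade both by
  the last coordinate.  The cone is simplicial, and each of its \<open>n\<close> rays \<open>v\<^sub>j\<close> has last coordinate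
  \<open>m = s\<^sub>n\<close>; cutting along one ray at a time shows that the series of \<open>L\<close> is \<open>P(x) / (1 - x\<^sup>m)\<^sup>n\<close>,
  where \<open>P\<close> enumerates the half-open parallelepiped spanned by the rays.  Point reflection of the
  parallelepiped shows that the series of \<open>L\<degree>\<close> is \<open>x\<^sup>e P*(x) / (1 - x\<^sup>m)\<^sup>n\<close>, where \<open>P*\<close> is the
  reversal of \<open>P\<close>.  Moreover \<open>Q(x) = P(x) (1 + x + \<dots> + x\<^bsup>m-1\<^esup>)\<close>, so that \<open>Q\<close> is palindromic iff
  \<open>P\<close> is, that is, iff the series of \<open>L\<degree>\<close> is a monomial times the series of \<open>L\<close>.  This is
  immediate if \<open>L\<degree> = c + L\<close>; conversely it gives a unique point \<open>c\<close> of lowest degree in \<open>L\<degree>\<close>, and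
  \<open>c + L \<subseteq> L\<degree>\<close> is an equality because both sides have equally many points in each degree.
\<close>

section \<open>Slack coordinates\<close>

text \<open>Coordinates of a point in the basis of rays \<open>cone_ray n s j\<close>: they turn the
  cone into the nonnegative orthant and its interior into the positive one. The value 0 at the
  missing index before \<open>0\<close> makes the first inequality of the cone look like the
  others.\<close>

definition slack :: "(nat \<Rightarrow> nat) \<Rightarrow> (nat \<Rightarrow> real) \<Rightarrow> nat \<Rightarrow> real" where
  "slack s x i = x i / real (s i) - (if i = 0 then 0 else x (i - 1) / real (s (i - 1)))"

text \<open>Basis dual to the slacks; the cone is its nonnegative span. The scaling makes each ray a
  lattice point, with the same last coordinate \<open>s (n - 1)\<close> for all
  \<open>j < n\<close>.\<close>

definition cone_ray :: "nat \<Rightarrow> (nat \<Rightarrow> nat) \<Rightarrow> nat \<Rightarrow> nat \<Rightarrow> real" where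
  "cone_ray n s j i = (if j \<le> i \<and> i < n then real (s i) else 0)"

text \<open>One notion for the cone, its interior, both half-open boxes and the mixtures that occur
  while coordinates are cut one at a time; hence a separate set for each index.\<close>

definition slack_points :: "nat \<Rightarrow> (nat \<Rightarrow> nat) \<Rightarrow> (nat \<Rightarrow> real set) \<Rightarrow> (nat \<Rightarrow> real) set" where
  "slack_points n s I = {x \<in> lattice_points n. \<forall>i<n. slack s x i \<in> I i}"

lemma slack_add: "slack s (\<lambda>i. x i + y i) i = slack s x i + slack s y i"
  by (simp add: slack_def add_divide_distrib)

lemma slack_diff: "slack s (\<lambda>i. x i - y i) i = slack s x i - slack s y i"
  by (simp add: slack_def diff_divide_distrib)

lemma slack_scale: "slack s (\<lambda>i. t * x i) i = t * slack s x i"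
  by (simp add: slack_def algebra_simps)

lemma slack_sum: "slack s (\<lambda>i. \<Sum>j\<in>A. f j i) i = (\<Sum>j\<in>A. slack s (f j) i)"
  by (simp add: slack_def sum_divide_distrib sum_subtractf)

lemma slack_cone_ray:
  assumes "\<And>i. s i > 0" "i < n" "j < n"
  shows "slack s (cone_ray n s j) i = (if i = j then 1 else 0)"
proof -
  have ray: "cone_ray n s j k / real (s k) = (if j \<le> k \<and> k < n then 1 else 0)" for k
    using assms(1)[of k] by (simp add: cone_ray_def)
  show ?thesis unfolding slack_def ray using assms(2,3) by auto
qed

lemma sum_slack: "(\<Sum>i\<le>j. slack s x i) = x j / real (s j)"
  by (induction j) (simp_all add: slack_def)

text \<open>The slacks telescope. Thus the degree of a point is \<open>s (n - 1)\<close> times its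
  total slack, and bounds on slacks become bounds on degrees.\<close>

lemma sum_slack_last:
  assumes "n \<ge> 1"
  shows "(\<Sum>i<n. slack s x i) = x (n - 1) / real (s (n - 1))"
proof -
  have "{..<n} = {..n - 1}" using assms by auto
  then show ?thesis by (simp add: sum_slack)
qed

lemma lattice_points_iff:
  "x \<in> lattice_points n \<longleftrightarrow> (\<forall>i<n. x i \<in> \<int>) \<and> (\<forall>i\<ge>n. x i = 0)"
  by (auto simp: lattice_points_def topspace_Euclidean_space)

lemma lattice_points_add:
  "x \<in> lattice_points n \<Longrightarrow> y \<in> lattice_points n \<Longrightarrow> (\<lambda>i. x i + y i) \<in> lattice_points n"
  by (auto simp: lattice_points_iff)

lemma lattice_points_diff:
  "x \<in> lattice_points n \<Longrightarrow> y \<in> lattice_points n \<Longrightarrow> (\<lambda>i. x i - y i) \<in> lattice_points n"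
  by (auto simp: lattice_points_iff)

lemma cone_ray_lattice: "cone_ray n s j \<in> lattice_points n"
  by (auto simp: lattice_points_iff cone_ray_def)

lemma lecture_hall_cone_slack:
  assumes "n \<ge> 1"
  shows "lecture_hall_cone n s = {x \<in> topspace (Euclidean_space n). \<forall>i<n. slack s x i \<ge> 0}"
proof -
  have "(0 \<le> x 0 / real (s 0) \<and>
          (\<forall>i. Suc i < n \<longrightarrow> x i / real (s i) \<le> x (Suc i) / real (s (Suc i)))) \<longleftrightarrow>
        (\<forall>i<n. slack s x i \<ge> 0)" (is "?A x \<longleftrightarrow> ?B x") for x
  proof
    assume A: "?A x"
    show "?B x"
    proof (intro allI impI)
      fix i assume "i < n"
      then show "slack s x i \<ge> 0" using A by (cases i) (auto simp: slack_def)
    qed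
  next
    assume B: "?B x"
    show "?A x"
    proof (intro conjI allI impI)
      show "0 \<le> x 0 / real (s 0)" using B[rule_format, of 0] assms by (simp add: slack_def)
      show "x i / real (s i) \<le> x (Suc i) / real (s (Suc i))" if "Suc i < n" for i
        using B[rule_format, OF that] by (simp add: slack_def)
    qed
  qed
  then show ?thesis unfolding lecture_hall_cone_def by blast
qed

lemma lecture_hall_partitions_slack:
  assumes "n \<ge> 1"
  shows "lecture_hall_partitions n s = slack_points n s (\<lambda>_. {0..})"
  by (auto simp: lecture_hall_partitions_def lecture_hall_cone_slack[OF assms] slack_points_def
      lattice_points_def)

section \<open>The interior of the cone\<close>

lemma continuous_map_slack:
  "continuous_map (Euclidean_space n) euclideanreal (\<lambda>x. slack s x i)"
  unfolding slack_def divide_inverse Euclidean_space_def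
  by (cases "i = 0")
     (auto intro!: continuous_intros continuous_map_from_subtopology continuous_map_product_projection)

text \<open>Slacks are continuous, so strict inequalities cut out an open set. Conversely, a small
  step from an interior point against the \<open>i\<close>-th ray stays in the cone and lowers slack
  \<open>i\<close> by the length of the step, so this slack was positive.\<close>

lemma interior_lecture_hall_cone:
  assumes s: "\<And>i. s i > 0" and n: "n \<ge> 1"
  shows "Euclidean_space n interior_of lecture_hall_cone n s =
         {x \<in> topspace (Euclidean_space n). \<forall>i<n. slack s x i > 0}" (is "?L = ?R")
proof
  have "openin (Euclidean_space n) {x \<in> topspace (Euclidean_space n). slack s x i \<in> {0<..}}" for i
    by (rule openin_continuous_map_preimage[OF continuous_map_slack]) simp
  then have "openin (Euclidean_space n) (topspace (Euclidean_space n) \<inter> 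
          (\<Inter>i\<in>{..<n}. {x \<in> topspace (Euclidean_space n). slack s x i \<in> {0<..}}))"
    by (intro openin_Int_Inter) blast+
  also have "topspace (Euclidean_space n) \<inter> 
          (\<Inter>i\<in>{..<n}. {x \<in> topspace (Euclidean_space n). slack s x i \<in> {0<..}}) = ?R"
    by auto
  finally have "openin (Euclidean_space n) ?R" .
  moreover have "?R \<subseteq> lecture_hall_cone n s"
    by (auto simp: lecture_hall_cone_slack[OF n] less_imp_le)
  ultimately show "?R \<subseteq> ?L" by (simp add: interior_of_maximal)
next
  show "?L \<subseteq> ?R"
  proof (intro subsetI CollectI conjI allI impI)
    fix x assume x: "x \<in> ?L"
    then show xt: "x \<in> topspace (Euclidean_space n)"
      by (rule subsetD[OF interior_of_subset_topspace])
    fix i assume i: "i < n"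
    let ?f = "\<lambda>t::real. \<lambda>k. x k - t * cone_ray n s i k"
    have "continuous_map euclideanreal (Euclidean_space n) ?f"
      unfolding Euclidean_space_def using xt
      by (auto simp: continuous_map_in_subtopology continuous_map_componentwise_UNIV
          topspace_Euclidean_space cone_ray_def intro!: continuous_intros)
    then have "openin euclideanreal {t \<in> topspace euclideanreal. ?f t \<in> ?L}"
      by (rule openin_continuous_map_preimage) simp
    then have "open {t. ?f t \<in> ?L}" by simp
    moreover have "0 \<in> {t. ?f t \<in> ?L}" using x by simp
    \<comment> \<open>A closed ball contains its endpoint \<open>e\<close>, which serves as the step
      length.\<close>
    ultimately obtain e where e: "e > 0" "cball 0 e \<subseteq> {t. ?f t \<in> ?L}"
      by (meson open_contains_cball)
    have "e \<in> cball 0 e" using e(1) by simp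
    then have "?f e \<in> lecture_hall_cone n s" using e(2) interior_of_subset by fastforce
    then have "slack s (?f e) i \<ge> 0" using i by (simp add: lecture_hall_cone_slack[OF n])
    then show "slack s x i > 0"
      using e(1) by (simp add: slack_diff slack_scale slack_cone_ray[of s i n i, OF s i i])
  qed
qed

section \<open>Generating functions by last coordinate\<close>

text \<open>An infinite fibre would be counted as 0 and a point whose last coordinate is not a
  natural number would be missed; the next two lemmas exclude this for the sets in question.\<close>

definition last_gf :: "nat \<Rightarrow> (nat \<Rightarrow> real) set \<Rightarrow> int fps" where
  "last_gf n A = Abs_fps (\<lambda>k. int (card {x \<in> A. x (n - 1) = real k}))"

lemma slack_points_last_nat:
  assumes s: "\<And>i. s i > 0" and n: "n \<ge> 1" and I: "\<And>i. I i \<subseteq> {0..}"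
    and x: "x \<in> slack_points n s I"
  shows "\<exists>k. x (n - 1) = real k"
proof -
  have "x (n - 1) / real (s (n - 1)) \<ge> 0"
    unfolding sum_slack_last[OF n, symmetric]
    using x I by (intro sum_nonneg) (force simp: slack_points_def)
  then have "x (n - 1) \<ge> 0" using s[of "n - 1"] by (simp add: zero_le_divide_iff)
  moreover have "x (n - 1) \<in> \<int>" using x n by (simp add: slack_points_def lattice_points_iff)
  ultimately show ?thesis by (metis Nats_altdef2 Nats_cases mem_Collect_eq)
qed

lemma finite_slack_points_le:
  assumes s: "\<And>i. s i > 0" and n: "n \<ge> 1" and I: "\<And>i. I i \<subseteq> {0..}"
  shows "finite {x \<in> slack_points n s I. x (n - 1) \<le> real t}"
proof -
  \<comment> \<open>A point of the cone of degree at most \<open>t\<close> has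
    \<open>x i \<le> t * s i\<close>, since \<open>s (n - 1) \<ge> 1\<close>; the sum of all
    \<open>s k\<close> gives one bound for all coordinates.\<close>
  have "finite {f. \<forall>i. (i \<in> {..<n} \<longrightarrow> f i \<in> real ` {..t * (\<Sum>k<n. s k)}) \<and> (i \<notin> {..<n} \<longrightarrow> f i = 0)}"
    by (rule finite_set_of_finite_funs) auto
  moreover have "x i \<in> real ` {..t * (\<Sum>k<n. s k)}"
    if x: "x \<in> slack_points n s I" "x (n - 1) \<le> real t" and i: "i < n" for x i
  proof -
    have "x \<in> lecture_hall_cone n s"
      using x I by (force simp: slack_points_def lecture_hall_cone_slack[OF n] lattice_points_def)
    note bnd = lecture_hall_cone_le_last[of s x n i, OF s this i]
    have pos: "real (s i) > 0" "real (s (n - 1)) \<ge> 1"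
      using s[of i] s[of "n - 1"] by auto
    have "x i / real (s i) \<le> real t / real (s (n - 1))"
      using bnd(2) divide_right_mono[OF x(2), of "real (s (n - 1))"] by simp
    also have "\<dots> \<le> real t" using pos(2) by (simp add: divide_le_eq mult_left_le mult_le_cancel_left1)
    finally have "x i \<le> real t * real (s i)" using pos(1) by (simp add: divide_le_eq)
    also have "\<dots> \<le> real (t * (\<Sum>k<n. s k))"
      using i member_le_sum[of i "{..<n}" s] by (simp flip: of_nat_mult of_nat_sum)
    finally have le: "x i \<le> real (t * (\<Sum>k<n. s k))" .
    have "x i \<in> \<int>" using x(1) i by (simp add: slack_points_def lattice_points_iff)
    moreover have "x i \<ge> 0" using bnd(1) pos(1) by (simp add: zero_le_divide_iff)
    ultimately obtain k where "x i = real k" by (metis Nats_altdef2 Nats_cases mem_Collect_eq)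
    then show ?thesis using le by (simp only: of_nat_le_iff) auto
  qed
  moreover have "x i = 0" if "x \<in> slack_points n s I" "i \<ge> n" for x i
    using that by (simp add: slack_points_def lattice_points_iff)
  ultimately show ?thesis
    by (elim finite_subset[rotated]) (auto simp: not_less)
qed

lemma finite_slack_points_fibre:
  assumes s: "\<And>i. s i > 0" and n: "n \<ge> 1" and I: "\<And>i. I i \<subseteq> {0..}"
  shows "finite {x \<in> slack_points n s I. x (n - 1) = real t}"
  by (rule finite_subset[OF _ finite_slack_points_le[of s n I t, OF s n I]]) auto

lemma last_gf_shift:
  assumes v: "v (n - 1) = real m" and A: "\<And>x. x \<in> A \<Longrightarrow> \<exists>k. x (n - 1) = real k"
  shows "last_gf n ((\<lambda>x i. v i + x i) ` A) = fps_X ^ m * last_gf n A"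
proof (rule fps_ext)
  fix k
  have inj: "inj_on (\<lambda>x i. v i + x i) B" for B :: "(nat \<Rightarrow> real) set"
    by (auto simp: inj_on_def fun_eq_iff)
  show "fps_nth (last_gf n ((\<lambda>x i. v i + x i) ` A)) k = fps_nth (fps_X ^ m * last_gf n A) k"
  proof (cases "k < m")
    case True
    \<comment> \<open>Degrees in \<open>A\<close> are nonnegative, so the translate has no point of
      degree below \<open>m\<close>.\<close>
    have empty: "{x \<in> (\<lambda>x i. v i + x i) ` A. x (n - 1) = real k} = {}"
      using True v A by fastforce
    show ?thesis
      unfolding last_gf_def fps_nth_Abs_fps empty fps_X_power_mult_nth using True by simp
  next
    case False
    then have eq: "{x \<in> (\<lambda>x i. v i + x i) ` A. x (n - 1) = real k} =
               (\<lambda>x i. v i + x i) ` {x \<in> A. x (n - 1) = real (k - m)}"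
      using v by (auto simp: of_nat_diff)
    show ?thesis
      unfolding last_gf_def fps_nth_Abs_fps eq fps_X_power_mult_nth card_image[OF inj]
      using False by simp
  qed
qed

lemma last_gf_Un:
  assumes "A \<inter> B = {}" "\<And>k. finite {x \<in> A. x (n - 1) = real k}"
    "\<And>k. finite {x \<in> B. x (n - 1) = real k}"
  shows "last_gf n (A \<union> B) = last_gf n A + last_gf n B"
proof (rule fps_ext)
  fix k
  have eq: "{x \<in> A \<union> B. x (n - 1) = real k} = {x \<in> A. x (n - 1) = real k} \<union> {x \<in> B. x (n - 1) = real k}"
    by auto
  have "card {x \<in> A \<union> B. x (n - 1) = real k} =
      card {x \<in> A. x (n - 1) = real k} + card {x \<in> B. x (n - 1) = real k}"
    unfolding eq using assms by (intro card_Un_disjoint) auto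
  then show "fps_nth (last_gf n (A \<union> B)) k = fps_nth (last_gf n A + last_gf n B) k"
    unfolding last_gf_def fps_add_nth fps_nth_Abs_fps by simp
qed

section \<open>Cutting along the rays\<close>

lemma slack_points_upd:
  assumes "j < n"
  shows "slack_points n s (I(j := M)) =
    {x \<in> lattice_points n. (\<forall>i<n. i \<noteq> j \<longrightarrow> slack s x i \<in> I i) \<and> slack s x j \<in> M}"
  using assms by (auto simp: slack_points_def split: if_splits)

text \<open>Adding the \<open>j\<close>-th ray raises slack \<open>j\<close> by one and fixes the
  others; as the ray is a lattice point, the step can be undone within the lattice.\<close>

lemma slack_points_shift_ray:
  assumes s: "\<And>i. s i > 0" and j: "j < n"
  shows "(\<lambda>x i. cone_ray n s j i + x i) ` slack_points n s I =
         slack_points n s (I(j := (+) 1 ` I j))"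
proof
  show "(\<lambda>x i. cone_ray n s j i + x i) ` slack_points n s I \<subseteq> slack_points n s (I(j := (+) 1 ` I j))"
    using s j by (auto simp: slack_points_def slack_add slack_cone_ray lattice_points_add cone_ray_lattice)
  show "slack_points n s (I(j := (+) 1 ` I j)) \<subseteq> (\<lambda>x i. cone_ray n s j i + x i) ` slack_points n s I"
  proof
    fix x assume x: "x \<in> slack_points n s (I(j := (+) 1 ` I j))"
    have "slack s x j \<in> (+) 1 ` I j" using x j by (simp add: slack_points_upd)
    then have "slack s x j - 1 \<in> I j" by auto
    then have "(\<lambda>i. x i - cone_ray n s j i) \<in> slack_points n s I"
      using x s j by (auto simp: slack_points_def slack_diff slack_cone_ray lattice_points_diff cone_ray_lattice
          split: if_splits)
    then show "x \<in> (\<lambda>x i. cone_ray n s j i + x i) ` slack_points n s I"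
      by (rule rev_image_eqI) simp
  qed
qed

text \<open>The points with slack \<open>j\<close> in the shifted part are the translate of the
  whole set by the \<open>j\<close>-th ray. With \<open>m = s (n - 1)\<close>, the series F of the
  whole and G of the rest satisfy F = G + x^m F.\<close>

lemma last_gf_cut:
  assumes s: "\<And>i. s i > 0" and n: "n \<ge> 1" and j: "j < n" and I: "\<And>i. I i \<subseteq> {0..}"
    and IK: "I j = K \<union> (+) 1 ` I j" "K \<inter> (+) 1 ` I j = {}"
  shows "last_gf n (slack_points n s (I(j := K))) =
         (1 - fps_X ^ s (n - 1)) * last_gf n (slack_points n s I)"
proof -
  let ?K = "I(j := K)" and ?S = "I(j := (+) 1 ` I j)"
  have sub: "?K i \<subseteq> {0..}" "?S i \<subseteq> {0..}" for i
    using I[of i] I[of j] IK(1) by auto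
  have "slack_points n s I = slack_points n s ?K \<union> slack_points n s ?S"
  proof -
    have "I = I(j := K \<union> (+) 1 ` I j)" by (simp only: IK(1)[symmetric] fun_upd_triv)
    then have "slack_points n s I = slack_points n s (I(j := K \<union> (+) 1 ` I j))" by (rule arg_cong)
    also have "\<dots> = slack_points n s ?K \<union> slack_points n s ?S"
      unfolding slack_points_upd[OF j] by blast
    finally show ?thesis .
  qed
  moreover have "slack_points n s ?K \<inter> slack_points n s ?S = {}"
    using IK(2) unfolding slack_points_upd[OF j] by blast
  ultimately have "last_gf n (slack_points n s I) =
      last_gf n (slack_points n s ?K) + last_gf n (slack_points n s ?S)"
    using finite_slack_points_fibre[of s n ?K, OF s n sub(1)]
      finite_slack_points_fibre[of s n ?S, OF s n sub(2)] by (simp add: last_gf_Un)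
  also have "last_gf n (slack_points n s ?S) = fps_X ^ s (n - 1) * last_gf n (slack_points n s I)"
    unfolding slack_points_shift_ray[of s j n, OF s j, symmetric]
  proof (rule last_gf_shift)
    show "cone_ray n s j (n - 1) = real (s (n - 1))" using j by (simp add: cone_ray_def)
    show "\<exists>k. x (n - 1) = real k" if "x \<in> slack_points n s I" for x
      using slack_points_last_nat[of s n I x, OF s n I that] by blast
  qed
  finally show ?thesis unfolding left_diff_distrib mult_1_left by (metis add_diff_cancel_right')
qed

lemma last_gf_parallelepiped:
  assumes s: "\<And>i. s i > 0" and n: "n \<ge> 1" and I: "I \<subseteq> {0..}"
    and IK: "I = K \<union> (+) 1 ` I" "K \<inter> (+) 1 ` I = {}"
  shows "last_gf n (slack_points n s (\<lambda>_. K)) =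
         (1 - fps_X ^ s (n - 1)) ^ n * last_gf n (slack_points n s (\<lambda>_. I))"
proof -
  \<comment> \<open>Induction on the number of coordinates already cut; each cut contributes one
    factor.\<close>
  have "last_gf n (slack_points n s (\<lambda>i. if i < j then K else I)) =
        (1 - fps_X ^ s (n - 1)) ^ j * last_gf n (slack_points n s (\<lambda>_. I))" if "j \<le> n" for j
    using that
  proof (induction j)
    case (Suc j)
    let ?I = "\<lambda>i. if i < j then K else I"
    have "(\<lambda>i. if i < Suc j then K else I) = ?I(j := K)" by (auto simp: fun_eq_iff less_Suc_eq)
    moreover have "?I i \<subseteq> {0..}" for i using I IK(1) by auto
    ultimately show ?case
      using last_gf_cut[of s n j ?I K, OF s n] Suc IK by simp
  qed simp
  from this[of n] have "last_gf n (slack_points n s (\<lambda>i. if i < n then K else I)) =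
        (1 - fps_X ^ s (n - 1)) ^ n * last_gf n (slack_points n s (\<lambda>_. I))" by simp
  moreover have "slack_points n s (\<lambda>i. if i < n then K else I) = slack_points n s (\<lambda>_. K)"
    by (auto simp: slack_points_def)
  ultimately show ?thesis by simp
qed

section \<open>The two half-open parallelepipeds\<close>

abbreviation partitions_gf :: "nat \<Rightarrow> (nat \<Rightarrow> nat) \<Rightarrow> int fps" where
  "partitions_gf n s \<equiv> last_gf n (slack_points n s (\<lambda>_. {0..}))"

abbreviation interior_gf :: "nat \<Rightarrow> (nat \<Rightarrow> nat) \<Rightarrow> int fps" where
  "interior_gf n s \<equiv> last_gf n (slack_points n s (\<lambda>_. {0<..}))"

abbreviation box_gf :: "nat \<Rightarrow> (nat \<Rightarrow> nat) \<Rightarrow> int fps" where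
  "box_gf n s \<equiv> last_gf n (slack_points n s (\<lambda>_. {0..<1}))"

lemma add_one_image: "(+) 1 ` {0..} = {1::real..}" "(+) 1 ` {0<..} = {1::real<..}"
proof -
  have *: "x \<in> (+) 1 ` A \<longleftrightarrow> x - 1 \<in> A" for x :: real and A by force
  show "(+) 1 ` {0..} = {1::real..}" "(+) 1 ` {0<..} = {1::real<..}"
    by (auto simp only: * set_eq_iff atLeast_iff greaterThan_iff)
qed

lemma box_gf_eq:
  assumes s: "\<And>i. s i > 0" and n: "n \<ge> 1"
  shows "box_gf n s = (1 - fps_X ^ s (n - 1)) ^ n * partitions_gf n s"
    "last_gf n (slack_points n s (\<lambda>_. {0<..1})) = (1 - fps_X ^ s (n - 1)) ^ n * interior_gf n s"
proof -
  \<comment> \<open>What the unit shift leaves out is [0,1) for the closed half-line and (0,1] for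
    the open one.\<close>
  have "{0..} = {0..<1::real} \<union> {1..}" "{0..<1::real} \<inter> {1..} = {}"
    "{0<..} = {0<..1::real} \<union> {1<..}" "{0<..1::real} \<inter> {1<..} = {}"
    by auto
  note cut = this[folded add_one_image]
  show "box_gf n s = (1 - fps_X ^ s (n - 1)) ^ n * partitions_gf n s"
    by (rule last_gf_parallelepiped[of s n "{0..}" "{0..<1}", OF s n _ cut(1,2)]) simp
  show "last_gf n (slack_points n s (\<lambda>_. {0<..1})) = (1 - fps_X ^ s (n - 1)) ^ n * interior_gf n s"
    by (rule last_gf_parallelepiped[of s n "{0<..}" "{0<..1}", OF s n _ cut(3,4)]) auto
qed

text \<open>All \<open>n\<close> slacks are below 1, so the total slack is below \<open>n\<close>.
  This makes \<open>box_gf\<close> a polynomial.\<close>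

lemma box_last_less:
  assumes s: "\<And>i. s i > 0" and n: "n \<ge> 1" and x: "x \<in> slack_points n s (\<lambda>_. {0..<1})"
  shows "x (n - 1) < real (n * s (n - 1))"
proof -
  have "(\<Sum>i<n. slack s x i) < (\<Sum>i<n. 1)"
    using x n by (intro sum_strict_mono) (auto simp: slack_points_def lessThan_empty_iff)
  then show ?thesis
    using s[of "n - 1"] by (simp add: sum_slack_last[OF n] divide_less_eq)
qed

text \<open>
  The reflection \<open>x \<mapsto> v\<^sub>1 + \<dots> + v\<^sub>n - x\<close> along the rays \<open>v\<^sub>j\<close> exchanges the two half-open
  parallelepipeds.
\<close>

lemma card_opposite_box:
  assumes s: "\<And>i. s i > 0" and n: "n \<ge> 1" and k: "k \<le> n * s (n - 1)"
  shows "card {x \<in> slack_points n s (\<lambda>_. {0<..1}). x (n - 1) = real k} =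
         card {x \<in> slack_points n s (\<lambda>_. {0..<1}). x (n - 1) = real (n * s (n - 1) - k)}"
proof -
  define V where "V = (\<lambda>i. \<Sum>j<n. cone_ray n s j i)"
  have V: "V \<in> lattice_points n"
    unfolding V_def lattice_points_iff by (auto simp: cone_ray_def)
  have slV: "slack s V i = 1" if "i < n" for i
    unfolding V_def slack_sum using that s by (simp add: slack_cone_ray)
  have Vn: "V (n - 1) = real (n * s (n - 1))"
  proof -
    have "V (n - 1) = (\<Sum>j<n. real (s (n - 1)))"
      unfolding V_def cone_ray_def by (intro sum.cong) auto
    then show ?thesis by simp
  qed
  \<comment> \<open>Subtraction from \<open>V\<close> is its own inverse; it takes slack t to 1 - t
    and degree \<open>k\<close> to \<open>n * s (n - 1) - k\<close>, an exact difference by the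
    assumption on \<open>k\<close>.\<close>
  show ?thesis
    by (rule bij_betw_same_card[of "\<lambda>x i. V i - x i"],
        rule bij_betw_byWitness[where f' = "\<lambda>x i. V i - x i"])
       (use V slV Vn k in \<open>auto simp: slack_points_def slack_diff lattice_points_diff of_nat_diff\<close>)
qed

section \<open>The $h^*$-polynomial\<close>

text \<open>Truncation loses nothing: \<open>box_gf\<close> vanishes from degree
  \<open>n * s (n - 1)\<close> on, by \<open>box_last_less\<close>.\<close>

definition box_poly :: "nat \<Rightarrow> (nat \<Rightarrow> nat) \<Rightarrow> int poly" where
  "box_poly n s = Poly (map (\<lambda>k. fps_nth (box_gf n s) k) [0..<n * s (n - 1)])"

lemma coeff_box_poly:
  assumes s: "\<And>i. s i > 0" and n: "n \<ge> 1"
  shows "coeff (box_poly n s) k = fps_nth (box_gf n s) k"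
proof (cases "k < n * s (n - 1)")
  case True
  then show ?thesis by (simp add: box_poly_def nth_default_def)
next
  case False
  have "real k < real (n * s (n - 1))"
    if "x \<in> slack_points n s (\<lambda>_. {0..<1})" "x (n - 1) = real k" for x
    using box_last_less[of s n x, OF s n that(1)] that(2) by simp
  then have empty: "{x \<in> slack_points n s (\<lambda>_. {0..<1}). x (n - 1) = real k} = {}"
    using False by (auto simp del: of_nat_mult)
  show ?thesis
    unfolding last_gf_def fps_nth_Abs_fps empty using False
    by (simp add: box_poly_def nth_default_def)
qed

lemma fps_of_box_poly:
  assumes s: "\<And>i. s i > 0" and n: "n \<ge> 1"
  shows "fps_of_poly (box_poly n s) = box_gf n s"
  by (rule fps_ext) (simp only: fps_of_poly_nth coeff_box_poly[of s n, OF s n])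

text \<open>In the cone the last ratio dominates all others, so the origin is the only point of
  degree 0.\<close>

lemma partitions_gf_0:
  assumes s: "\<And>i. s i > 0" and n: "n \<ge> 1"
  shows "fps_nth (partitions_gf n s) 0 = 1"
proof -
  have "x i = 0" if x: "x \<in> slack_points n s (\<lambda>_. {0..})" "x (n - 1) = 0" for x i
  proof (cases "i < n")
    case True
    have "x \<in> lecture_hall_cone n s"
      using x by (simp add: slack_points_def lecture_hall_cone_slack[OF n] lattice_points_def)
    from lecture_hall_cone_le_last[of s x n i, OF s this True] show ?thesis
      using x(2) s[of i] by simp
  qed (use x in \<open>simp add: slack_points_def lattice_points_iff\<close>)
  moreover have "(\<lambda>_. 0) \<in> slack_points n s (\<lambda>_. {0..})"
    by (simp add: slack_points_def lattice_points_iff slack_def)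
  ultimately have zero: "{x \<in> slack_points n s (\<lambda>_. {0..}). x (n - 1) = real 0} = {\<lambda>_. 0}"
    unfolding of_nat_0 by (intro equalityI subsetI CollectI conjI) (blast | simp)+
  show ?thesis unfolding last_gf_def fps_nth_Abs_fps zero by simp
qed

text \<open>A nonzero constant term ensures that \<open>reflect_poly\<close> drops no zeros and
  keeps the degree.\<close>

lemma coeff_box_poly_0:
  assumes s: "\<And>i. s i > 0" and n: "n \<ge> 1"
  shows "coeff (box_poly n s) 0 = 1"
proof -
  have "fps_nth ((1 - fps_X ^ s (n - 1)) ^ n :: int fps) 0 = 1"
    using s[of "n - 1"] by (simp add: fps_nth_power_0 power_0_left)
  then show ?thesis
    unfolding coeff_box_poly[of s n, OF s n] box_gf_eq(1)[of s n, OF s n] fps_mult_nth_0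
      partitions_gf_0[of s n, OF s n] by simp
qed

text \<open>The left side is the series of the box with slacks in (0,1], whose coefficients are
  those of \<open>box_poly\<close> reversed about \<open>n * s (n - 1)\<close>. As
  \<open>reflect_poly\<close> reverses about the degree instead, the gap between the two appears as
  a power of x.\<close>

lemma opposite_box_gf:
  assumes s: "\<And>i. s i > 0" and n: "n \<ge> 1"
  shows "(1 - fps_X ^ s (n - 1)) ^ n * interior_gf n s =
         fps_X ^ (n * s (n - 1) - degree (box_poly n s)) * fps_of_poly (reflect_poly (box_poly n s))"
proof (rule fps_ext)
  fix k
  let ?N = "n * s (n - 1)" and ?p = "box_poly n s"
  have coeff: "coeff ?p i = int (card {x \<in> slack_points n s (\<lambda>_. {0..<1}). x (n - 1) = real i})" for i
    by (simp add: coeff_box_poly[of s n, OF s n] last_gf_def)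
  have "degree ?p \<le> ?N"
    by (rule degree_le) (simp add: box_poly_def nth_default_def)
  then have r: "fps_nth (fps_X ^ (?N - degree ?p) * fps_of_poly (reflect_poly ?p)) k =
      (if k \<le> ?N then coeff ?p (?N - k) else 0)"
    by (auto simp: fps_X_power_mult_nth coeff_reflect_poly coeff_eq_0)
  have l: "fps_nth ((1 - fps_X ^ s (n - 1)) ^ n * interior_gf n s) k =
      int (card {x \<in> slack_points n s (\<lambda>_. {0<..1}). x (n - 1) = real k})"
    unfolding box_gf_eq(2)[of s n, OF s n, symmetric] by (simp add: last_gf_def)
  \<comment> \<open>Beyond \<open>?N\<close> the point reflection says nothing, and the truncated
    difference \<open>?N - k\<close> would be 0; there the box is empty.\<close>
  have "x (n - 1) \<le> real ?N" if "x \<in> slack_points n s (\<lambda>_. {0<..1})" for x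
  proof -
    have "(\<Sum>i<n. slack s x i) \<le> (\<Sum>i<n. 1)"
      using that by (intro sum_mono) (auto simp: slack_points_def)
    then show ?thesis using s[of "n - 1"] by (simp add: sum_slack_last[OF n] divide_le_eq)
  qed
  then have "{x \<in> slack_points n s (\<lambda>_. {0<..1}). x (n - 1) = real k} = {}" if "k > ?N"
    using that by (force simp del: of_nat_mult)
  then have "card {x \<in> slack_points n s (\<lambda>_. {0<..1}). x (n - 1) = real k} = 0" if "k > ?N"
    using that by (simp only: card.empty)
  then show "fps_nth ((1 - fps_X ^ s (n - 1)) ^ n * interior_gf n s) k =
      fps_nth (fps_X ^ (?N - degree ?p) * fps_of_poly (reflect_poly ?p)) k"
    unfolding l r coeff using card_opposite_box[of s n k, OF s n] by (auto simp: not_le)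
qed

text \<open>Multiplication by 1 - x takes differences of consecutive coefficients, which turns the
  count up to a degree into the count in that degree.\<close>

lemma ehrhart_series_partitions_gf:
  assumes s: "\<And>i. s i > 0" and n: "n \<ge> 1"
  shows "(1 - fps_X) * lecture_hall_ehrhart_series n s = partitions_gf n s"
proof (rule fps_ext)
  fix k
  let ?A = "slack_points n s (\<lambda>_. {0..})"
  have nat: "\<exists>k. x (n - 1) = real k" if "x \<in> ?A" for x
    using slack_points_last_nat[of s n "\<lambda>_. {0..}" x, OF s n _ that] by auto
  have fin: "finite {x \<in> ?A. x (n - 1) \<le> real t}" "finite {x \<in> ?A. x (n - 1) = real t}" for t
    using finite_slack_points_le[of s n "\<lambda>_. {0..}", OF s n]
      finite_slack_points_fibre[of s n "\<lambda>_. {0..}", OF s n] by auto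
  show "fps_nth ((1 - fps_X) * lecture_hall_ehrhart_series n s) k = fps_nth (partitions_gf n s) k"
  proof (cases k)
    case 0
    have "{x \<in> ?A. x (n - 1) \<le> 0} = {x \<in> ?A. x (n - 1) = 0}"
      using nat by fastforce
    then show ?thesis
      by (simp add: 0 lecture_hall_ehrhart_series_def lecture_hall_ehrhart_def last_gf_def
          lecture_hall_partitions_slack[OF n])
  next
    case (Suc t)
    have "y \<le> real t \<or> y = real (Suc t) \<longleftrightarrow> y \<le> real (Suc t)" if "\<exists>k. y = real k" for y
      using that by (auto simp only: of_nat_le_iff of_nat_eq_iff le_Suc_eq)
    then have "{x \<in> ?A. x (n - 1) \<le> real (Suc t)} =
        {x \<in> ?A. x (n - 1) \<le> real t} \<union> {x \<in> ?A. x (n - 1) = real (Suc t)}"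
      using nat by blast
    then have "card {x \<in> ?A. x (n - 1) \<le> real (Suc t)} =
        card {x \<in> ?A. x (n - 1) \<le> real t} + card {x \<in> ?A. x (n - 1) = real (Suc t)}"
      using fin by (simp add: card_Un_disjoint disjoint_iff del: of_nat_Suc)
    then show ?thesis
      by (simp add: Suc lecture_hall_ehrhart_series_def lecture_hall_ehrhart_def last_gf_def
          lecture_hall_partitions_slack[OF n] left_diff_distrib del: of_nat_Suc)
  qed
qed

text \<open>The quotient (1 - x^m) / (1 - x).\<close>

definition ones_poly :: "nat \<Rightarrow> int poly" where
  "ones_poly m = Poly (replicate m 1)"

lemma coeff_ones_poly: "coeff (ones_poly m) k = (if k < m then 1 else 0)"
  by (simp add: ones_poly_def nth_default_def)

lemma reflect_ones_poly: "m > 0 \<Longrightarrow> reflect_poly (ones_poly m) = ones_poly m"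
proof (rule poly_eqI)
  fix k
  assume m: "m > 0"
  have "degree (ones_poly m) = m - 1"
    using m by (intro antisym degree_le le_degree) (auto simp: coeff_ones_poly)
  then show "coeff (reflect_poly (ones_poly m)) k = coeff (ones_poly m) k"
    using m by (auto simp: coeff_reflect_poly coeff_ones_poly)
qed

lemma ones_poly_telescope: "(1 - fps_X) * fps_of_poly (ones_poly m) = 1 - fps_X ^ m"
  by (rule fps_ext) (auto simp: left_diff_distrib fps_X_power_nth coeff_ones_poly)

text \<open>One of the \<open>n + 1\<close> factors splits as (1 - x) times
  \<open>ones_poly\<close>; its 1 - x turns the Ehrhart series into \<open>partitions_gf\<close>,
  which the other \<open>n\<close> factors turn into \<open>box_gf\<close>.\<close>

lemma h_star_polynomial_eq:
  assumes s: "\<And>i. s i > 0" and n: "n \<ge> 1"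
  shows "h_star_polynomial n s = box_poly n s * ones_poly (s (n - 1))"
  unfolding h_star_polynomial_def
proof (rule the1_equality')
  let ?m = "s (n - 1)"
  have "(1 - fps_X ^ ?m) ^ (n + 1) * lecture_hall_ehrhart_series n s =
      (1 - fps_X ^ ?m) ^ n * ((1 - fps_X) * lecture_hall_ehrhart_series n s) * fps_of_poly (ones_poly ?m)"
    by (simp add: ones_poly_telescope[symmetric] mult_ac)
  also have "\<dots> = fps_of_poly (box_poly n s * ones_poly ?m)"
    using s n by (simp add: ehrhart_series_partitions_gf fps_of_poly_mult fps_of_box_poly box_gf_eq(1))
  finally show "fps_of_poly (box_poly n s * ones_poly ?m) =
      (1 - fps_X ^ ?m) ^ (n + 1) * lecture_hall_ehrhart_series n s" ..
  then show "\<exists>\<^sub>\<le>\<^sub>1 Q. fps_of_poly Q = (1 - fps_X ^ ?m) ^ (n + 1) * lecture_hall_ehrhart_series n s"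
    by (metis (mono_tags, lifting) Uniq_I fps_of_poly_eq_iff)
qed

lemma symmetric_coeffs_iff:
  assumes "coeff p 0 \<noteq> 0"
  shows "symmetric_vector (coeffs p) \<longleftrightarrow> reflect_poly p = p"
proof -
  \<comment> \<open>\<open>reflect_poly\<close> strips low-order zeros before reversing; here there
    are none.\<close>
  have "dropWhile ((=) 0) (coeffs p) = coeffs p"
    using assms by (cases p) (auto simp: cCons_def)
  then show ?thesis by (simp add: symmetric_vector_def coeffs_eq_iff coeffs_reflect_poly)
qed

text \<open>Reflection is multiplicative and fixes the nonzero factor \<open>ones_poly\<close>,
  which therefore cancels.\<close>

lemma symmetric_h_star_iff:
  assumes s: "\<And>i. s i > 0" and n: "n \<ge> 1"
  shows "symmetric_vector (h_star_vector n s) \<longleftrightarrow> reflect_poly (box_poly n s) = box_poly n s"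
proof -
  have "ones_poly (s (n - 1)) \<noteq> 0"
    using s[of "n - 1"] coeff_ones_poly[of "s (n - 1)" 0] by auto
  moreover have "coeff (box_poly n s * ones_poly (s (n - 1))) 0 \<noteq> 0"
    using s n by (simp add: coeff_mult coeff_box_poly_0 coeff_ones_poly)
  ultimately show ?thesis
    unfolding h_star_vector_def h_star_polynomial_eq[of s n, OF s n]
    using s by (simp add: symmetric_coeffs_iff reflect_poly_mult reflect_ones_poly)
qed

section \<open>Symmetry and the Gorenstein property\<close>

lemma gorenstein_iff:
  assumes s: "\<And>i. s i > 0" and n: "n \<ge> 1"
  shows "gorenstein_cone n (lecture_hall_cone n s) \<longleftrightarrow>
    (\<exists>c\<in>slack_points n s (\<lambda>_. {0<..}).
       slack_points n s (\<lambda>_. {0<..}) = (\<lambda>x i. c i + x i) ` slack_points n s (\<lambda>_. {0..}))"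
proof -
  have "Euclidean_space n interior_of lecture_hall_cone n s \<inter> lattice_points n =
        slack_points n s (\<lambda>_. {0<..})"
    unfolding interior_lecture_hall_cone[of s n, OF s n]
    by (auto simp: slack_points_def lattice_points_def)
  then show ?thesis
    by (simp add: gorenstein_cone_def lecture_hall_partitions_slack[OF n]
        flip: lecture_hall_partitions_def)
qed

lemma one_minus_fps_X_power_nonzero:
  assumes "m > 0"
  shows "(1 - fps_X ^ m :: int fps) ^ n \<noteq> 0"
proof -
  have "fps_nth (1 - fps_X ^ m :: int fps) 0 \<noteq> 0" using assms by simp
  then have "1 - fps_X ^ m \<noteq> (0 :: int fps)" by (metis fps_zero_nth)
  then show ?thesis by simp
qed

lemma gorenstein_imp_reflect:
  assumes s: "\<And>i. s i > 0" and n: "n \<ge> 1"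
    and c: "c \<in> slack_points n s (\<lambda>_. {0<..})"
    and eq: "slack_points n s (\<lambda>_. {0<..}) = (\<lambda>x i. c i + x i) ` slack_points n s (\<lambda>_. {0..})"
  shows "reflect_poly (box_poly n s) = box_poly n s"
proof -
  let ?p = "box_poly n s" and ?m = "n * s (n - 1) - degree (box_poly n s)"
  have pos: "{0<..} \<subseteq> {0::real..}" by auto
  obtain k where k: "c (n - 1) = real k"
    using slack_points_last_nat[of s n "\<lambda>_. {0<..}" c, OF s n pos c] by blast
  have "\<exists>k. x (n - 1) = real k" if "x \<in> slack_points n s (\<lambda>_. {0..})" for x
    using slack_points_last_nat[of s n "\<lambda>_. {0..}" x, OF s n _ that] by auto
  then have "interior_gf n s = fps_X ^ k * partitions_gf n s"
    unfolding eq using k by (intro last_gf_shift) auto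
  then have "fps_X ^ ?m * fps_of_poly (reflect_poly ?p) = fps_X ^ k * fps_of_poly ?p"
    using opposite_box_gf[of s n, OF s n] fps_of_box_poly[of s n, OF s n] box_gf_eq(1)[of s n, OF s n]
    by (simp add: mult_ac)
  \<comment> \<open>Back to polynomials, so that degrees can be compared.\<close>
  then have "fps_of_poly (monom 1 ?m * reflect_poly ?p) = fps_of_poly (monom 1 k * ?p)"
    by (simp add: fps_of_poly_mult fps_of_poly_monom')
  then have *: "monom 1 ?m * reflect_poly ?p = monom 1 k * ?p"
    by (simp add: fps_of_poly_eq_iff)
  have 0: "coeff ?p 0 \<noteq> 0" using coeff_box_poly_0[of s n, OF s n] by simp
  then have "?p \<noteq> 0" "reflect_poly ?p \<noteq> 0" by auto
  \<comment> \<open>Reflection preserves the degree, so the two monomials must agree and can be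
    cancelled.\<close>
  then have "?m + degree ?p = k + degree ?p"
    using arg_cong[OF *, of degree] 0 by (simp add: degree_mult_eq degree_monom_eq)
  then have "monom 1 ?m = (monom 1 k :: int poly)" by simp
  moreover have "monom 1 k \<noteq> (0 :: int poly)" by simp
  ultimately show ?thesis using * by (metis mult_left_cancel)
qed

lemma reflect_imp_gorenstein:
  assumes s: "\<And>i. s i > 0" and n: "n \<ge> 1"
    and refl: "reflect_poly (box_poly n s) = box_poly n s"
  shows "\<exists>c\<in>slack_points n s (\<lambda>_. {0<..}).
     slack_points n s (\<lambda>_. {0<..}) = (\<lambda>x i. c i + x i) ` slack_points n s (\<lambda>_. {0..})"
proof -
  let ?L = "slack_points n s (\<lambda>_. {0..})" and ?I = "slack_points n s (\<lambda>_. {0<..})"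
  have pos: "{0<..} \<subseteq> {0::real..}" by auto
  define m where "m = n * s (n - 1) - degree (box_poly n s)"
  have "(1 - fps_X ^ s (n - 1)) ^ n * interior_gf n s =
        (1 - fps_X ^ s (n - 1)) ^ n * (fps_X ^ m * partitions_gf n s)"
    using opposite_box_gf[of s n, OF s n] fps_of_box_poly[of s n, OF s n] box_gf_eq(1)[of s n, OF s n] refl
    by (simp add: m_def mult_ac)
  then have gf: "interior_gf n s = fps_X ^ m * partitions_gf n s"
    using one_minus_fps_X_power_nonzero[OF s[of "n - 1"], of n] by (metis mult_left_cancel)
  then have "fps_nth (interior_gf n s) m = 1"
    using partitions_gf_0[of s n, OF s n] by (simp add: fps_X_power_mult_nth)
  \<comment> \<open>The constant term 1 of \<open>partitions_gf\<close>, moved to degree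
    \<open>m\<close>, yields the Gorenstein point.\<close>
  then have "card {x \<in> ?I. x (n - 1) = real m} \<noteq> 0" by (simp add: last_gf_def)
  then obtain c where c: "c \<in> ?I" "c (n - 1) = real m"
    by (metis (mono_tags, lifting) card.empty empty_Collect_eq)
  let ?T = "(\<lambda>x i. c i + x i) ` ?L"
  have nat: "\<exists>k. x (n - 1) = real k" if "x \<in> ?L" for x
    using slack_points_last_nat[of s n "\<lambda>_. {0..}" x, OF s n _ that] by auto
  have sub: "?T \<subseteq> ?I"
    using c(1) by (auto simp: slack_points_def slack_add lattice_points_add add_pos_nonneg)
  \<comment> \<open>Since \<open>c\<close> has degree \<open>m\<close>, its translate of
    \<open>?L\<close> has the series x^m \<open>partitions_gf\<close>, which is that of
    \<open>?I\<close>.\<close>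
  have "last_gf n ?T = interior_gf n s"
    unfolding gf using c(2) nat by (rule last_gf_shift)
  then have card: "card {x \<in> ?T. x (n - 1) = real k} = card {x \<in> ?I. x (n - 1) = real k}" for k
    by (simp add: last_gf_def fps_eq_iff)
  have "?I \<subseteq> ?T"
  proof
    fix x assume x: "x \<in> ?I"
    then obtain k where k: "x (n - 1) = real k"
      using slack_points_last_nat[of s n "\<lambda>_. {0<..}" x, OF s n pos] by blast
    \<comment> \<open>In each degree, an inclusion of finite sets of equal size is an
      equality.\<close>
    have "finite {x \<in> ?I. x (n - 1) = real k}"
      by (rule finite_slack_points_fibre[of s n "\<lambda>_. {0<..}", OF s n pos])
    moreover have "{x \<in> ?T. x (n - 1) = real k} \<subseteq> {x \<in> ?I. x (n - 1) = real k}"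
      using sub by blast
    ultimately have "{x \<in> ?T. x (n - 1) = real k} = {x \<in> ?I. x (n - 1) = real k}"
      using card by (simp add: card_subset_eq)
    then show "x \<in> ?T" using x k by blast
  qed
  then show ?thesis using c(1) sub by blast
qed

theorem theorem4p1:
  fixes s :: "nat \<Rightarrow> nat" and n :: nat
  assumes "\<And>i. s i > 0" and "n \<ge> 1"
  shows "symmetric_vector (h_star_vector n s) \<longleftrightarrow> gorenstein_cone n (lecture_hall_cone n s)"
  unfolding symmetric_h_star_iff[of s n, OF assms] gorenstein_iff[of s n, OF assms]
  using gorenstein_imp_reflect[of s n, OF assms] reflect_imp_gorenstein[of s n, OF assms] by blast

end
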